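(* Assume that the control constraint set $\mathcal{U}\subset\mathbb{R}^m$ is a closed convex polytope that contains the nominal control $k(x)$. Then: 1. If $\gamma>0$ is not chosen properly, there may not exist $\delta$ making the CLF-CBF QP feasible: there exist a system with such data, a parameter $\gamma>0$ and a state $x$ for which no $(u,\delta)\in\mathbb{R}^m\times\mathbb{R}$ satisfies the constraints of the CLF-CBF QP at $x$. 2. If $h(x)\ne0$, then there always exist $\delta,\omega\in\mathbb{R}$ such that the Optimal-decay CLF-CBF QP is feasible at $x$ (i.e. there are $u,\delta,\omega$ satisfying all of its constraints). 3. The Safety-first CLF-CBF QP is feasible at any state $x$ (i.e. each of its three nested sub-problems is feasible at $x$).
   Context: Setting: a control-affine system $\dot x=f(x)+g(x)u$, $x\in\mathbb{R}^n$, $u\in\mathcal{U}\subset\mathbb{R}^m$, with $f,g$ locally Lipschitz; $k:\mathbb{R}^n\to\mathbb{R}^m$ a nominal controller; $\lambda,\gamma,\gamma_0>0$; $H$ symmetric positive definite. Lie derivatives: $L_fV(x)=\nabla V(x)^Tf(x)$, $L_gV(x)=\nabla V(x)^Tg(x)$, and similarly for $h$. $V$ is an exponentially stabilizing control Lyapunov function: $V$ is $C^1$ and there are $c_1,c_2,c_3>0$ with $c_1\|x\|^2\le V(x)\le c_2\|x\|^2$ and $\inf_{u\in\mathcal{U}}[L_fV(x)+L_gV(x)u+c_3V(x)]\le0$ for all $x$. $h$ is a (zeroing) control barrier function: $h$ is $C^1$ and there is a continuous, strictly increasing $\alpha:\mathbb{R}\to\mathbb{R}$ with $\alpha(0)=0$,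 $\alpha(r)\to\pm\infty$ as $r\to\pm\infty$, such that $\sup_{u\in\mathcal{U}}[L_fh(x)+L_gh(x)u+\alpha(h(x))]\ge0$. The parameters $\lambda,\gamma$ are user-chosen and need not be related to $c_3,\alpha$. CLF-CBF QP at $x$: minimize $\frac12(u-k(x))^TH(u-k(x))+p\delta^2$ over $(u,\delta)$ subject to $L_fV(x)+L_gV(x)u+\lambda V(x)\le\delta$, $L_fh(x)+L_gh(x)u+\gamma h(x)\ge0$, $u\in\mathcal{U}$. Optimal-decay CLF-CBF QP at $x$: minimize $\frac12(u-k(x))^TH(u-k(x))+p\delta^2+p_\omega(\omega-\omega_0)^2$ over $(u,\delta,\omega)\in\mathbb{R}^m\times\mathbb{R}\times\mathbb{R}$ subject to $L_fV(x)+L_gV(x)u+\lambda V(x)\le\delta$, $L_fh(x)+L_gh(x)u+\omega\gamma_0h(x)\ge0$, $u\in\mathcal{U}$. ($p,p_\omega>0$ weights, $\omega_0\in\mathbb{R}$.) Safety-first CLF-CBF QP at $x$ consists of three nested problems, all with the constraints $L_fV(x)+L_gV(x)u+\lambda V(x)\le\delta_1$, $L_fh(x)+L_gh(x)u+\gamma h(x)\ge\delta_2$, $u\in\mathcal{U}$: Sub-problem 1 minimizes $\delta_2^2$ over $(u,\delta_1,\delta_2)$, giving $\delta_2^*$; Sub-problem 2 fixes $\delta_2=\delta_2^*$ and minimizes $\delta_1^2$ over $(u,\delta_1)$, giving $\delta_1^*$; Sub-problem 3 fixes $\delta_1=\delta_1^*,\delta_2=\delta_2^*$ and minimizes $(u-k(x))^TH(u-k(x))$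 over $u$, giving the control input $u^*$. *)

theory Defs
  imports "HOL-Analysis.Analysis"
begin

section \<open>Gradients and Lie derivatives\<close>

definition grad :: "(real^'n \<Rightarrow> real) \<Rightarrow> real^'n \<Rightarrow> real^'n" where
  "grad W x = (THE d. GDERIV W x :> d)"

definition C1_function :: "(real^'n \<Rightarrow> real) \<Rightarrow> bool" where
  "C1_function W \<longleftrightarrow> (\<forall>x. W differentiable (at x)) \<and> continuous_on UNIV (grad W)"

definition lie :: "(real^'n \<Rightarrow> real^'n) \<Rightarrow> (real^'n \<Rightarrow> real) \<Rightarrow> real^'n \<Rightarrow> real" where
  "lie f W x = grad W x \<bullet> f x"

text \<open>For the input matrix \<open>g\<close> the Lie derivative is the row vector \<open>(\<nabla>W)\<^sup>T g\<close>;
  it acts on an input \<open>u\<close> as \<open>lie_row g W x \<bullet> u\<close>.\<close>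

definition lie_row :: "(real^'n \<Rightarrow> real^'m^'n) \<Rightarrow> (real^'n \<Rightarrow> real) \<Rightarrow> real^'n \<Rightarrow> real^'m" where
  "lie_row g W x = grad W x v* g x"

section \<open>Control Lyapunov and control barrier functions\<close>

text \<open>Infimum and supremum over the inputs are taken in the extended reals, so that they are
  meaningful for every input set.\<close>

definition exp_stabilizing_CLF ::
  "(real^'n \<Rightarrow> real^'n) \<Rightarrow> (real^'n \<Rightarrow> real^'m^'n) \<Rightarrow> (real^'m) set \<Rightarrow> (real^'n \<Rightarrow> real) \<Rightarrow> bool" where
  "exp_stabilizing_CLF f g U V \<longleftrightarrow> C1_function V \<and>
     (\<exists>c1 c2 c3. c1 > 0 \<and> c2 > 0 \<and> c3 > 0 \<and>
        (\<forall>x. c1 * (norm x)\<^sup>2 \<le> V x \<and> V x \<le> c2 * (norm x)\<^sup>2) \<and>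
        (\<forall>x. (INF u\<in>U. ereal (lie f V x + lie_row g V x \<bullet> u + c3 * V x)) \<le> 0))"

definition extended_class_K_infinity :: "(real \<Rightarrow> real) \<Rightarrow> bool" where
  "extended_class_K_infinity \<alpha> \<longleftrightarrow> continuous_on UNIV \<alpha> \<and> strict_mono \<alpha> \<and> \<alpha> 0 = 0 \<and>
     filterlim \<alpha> at_top at_top \<and> filterlim \<alpha> at_bot at_bot"

definition zeroing_CBF ::
  "(real^'n \<Rightarrow> real^'n) \<Rightarrow> (real^'n \<Rightarrow> real^'m^'n) \<Rightarrow> (real^'m) set \<Rightarrow> (real^'n \<Rightarrow> real) \<Rightarrow> bool" where
  "zeroing_CBF f g U h \<longleftrightarrow> C1_function h \<and>
     (\<exists>\<alpha>. extended_class_K_infinity \<alpha> \<and>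
        (\<forall>x. (SUP u\<in>U. ereal (lie f h x + lie_row g h x \<bullet> u + \<alpha> (h x))) \<ge> 0))"

section \<open>The control problem\<close>

record ('n, 'm) control_data =
  drift :: "real^'n \<Rightarrow> real^'n"
  input_matrix :: "real^'n \<Rightarrow> real^'m^'n"
  inputs :: "(real^'m) set"
  nominal :: "real^'n \<Rightarrow> real^'m"
  lyapunov :: "real^'n \<Rightarrow> real"
  barrier :: "real^'n \<Rightarrow> real"
  weight :: "real^'m^'m"

definition symmetric_positive_definite :: "real^'m^'m \<Rightarrow> bool" where
  "symmetric_positive_definite A \<longleftrightarrow> transpose A = A \<and> (\<forall>v. v \<noteq> 0 \<longrightarrow> v \<bullet> (A *v v) > 0)"

text \<open>The first argument of \<^const>\<open>local_lipschitz\<close> is a time domain, which plays no role for the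
  autonomous maps considered here.\<close>

definition control_setting :: "('n::finite, 'm::finite) control_data \<Rightarrow> bool" where
  "control_setting S \<longleftrightarrow>
     local_lipschitz (UNIV :: real set) UNIV (\<lambda>_. drift S) \<and>
     local_lipschitz (UNIV :: real set) UNIV (\<lambda>_. input_matrix S) \<and>
     exp_stabilizing_CLF (drift S) (input_matrix S) (inputs S) (lyapunov S) \<and>
     zeroing_CBF (drift S) (input_matrix S) (inputs S) (barrier S) \<and>
     symmetric_positive_definite (weight S)"

text \<open>Closedness and convexity are implied by \<^const>\<open>polytope\<close>.\<close>

definition polytopic_inputs :: "('n::finite, 'm::finite) control_data \<Rightarrow> bool" where
  "polytopic_inputs S \<longleftrightarrow> polytope (inputs S) \<and> (\<forall>x. nominal S x \<in> inputs S)"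

text \<open>The left-hand sides \<open>L\<^sub>f W(x) + L\<^sub>g W(x) u\<close> for \<open>W = V\<close> and \<open>W = h\<close>.\<close>

definition lyapunov_rate ::
  "('n::finite, 'm::finite) control_data \<Rightarrow> real^'n \<Rightarrow> real^'m \<Rightarrow> real" where
  "lyapunov_rate S x u =
     lie (drift S) (lyapunov S) x + lie_row (input_matrix S) (lyapunov S) x \<bullet> u"

definition barrier_rate ::
  "('n::finite, 'm::finite) control_data \<Rightarrow> real^'n \<Rightarrow> real^'m \<Rightarrow> real" where
  "barrier_rate S x u =
     lie (drift S) (barrier S) x + lie_row (input_matrix S) (barrier S) x \<bullet> u"

definition deviation_cost ::
  "('n::finite, 'm::finite) control_data \<Rightarrow> real^'n \<Rightarrow> real^'m \<Rightarrow> real" where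
  "deviation_cost S x u = (u - nominal S x) \<bullet> (weight S *v (u - nominal S x))"

section \<open>Optimization problems\<close>

datatype 'a program = Minimize (objective: "'a \<Rightarrow> real") (feasible_set: "'a set")

definition feasible :: "'a program \<Rightarrow> bool" where
  "feasible P \<longleftrightarrow> feasible_set P \<noteq> {}"

definition minimizer :: "'a program \<Rightarrow> 'a \<Rightarrow> bool" where
  "minimizer P z \<longleftrightarrow> is_arg_min (objective P) (\<lambda>y. y \<in> feasible_set P) z"

definition CLF_CBF_QP ::
  "('n::finite, 'm::finite) control_data \<Rightarrow> real \<Rightarrow> real \<Rightarrow> real \<Rightarrow> real^'n \<Rightarrow>
     ((real^'m) \<times> real) program" where
  "CLF_CBF_QP S lam gam p x = Minimize
     (\<lambda>(u, \<delta>). 1/2 * deviation_cost S x u + p * \<delta>\<^sup>2)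
     {(u, \<delta>). lyapunov_rate S x u + lam * lyapunov S x \<le> \<delta> \<and>
        barrier_rate S x u + gam * barrier S x \<ge> 0 \<and> u \<in> inputs S}"

definition optimal_decay_QP ::
  "('n::finite, 'm::finite) control_data \<Rightarrow> real \<Rightarrow> real \<Rightarrow> real \<Rightarrow> real \<Rightarrow> real \<Rightarrow> real^'n \<Rightarrow>
     ((real^'m) \<times> real \<times> real) program" where
  "optimal_decay_QP S lam gam0 p p\<omega> \<omega>0 x = Minimize
     (\<lambda>(u, \<delta>, \<omega>). 1/2 * deviation_cost S x u + p * \<delta>\<^sup>2 + p\<omega> * (\<omega> - \<omega>0)\<^sup>2)
     {(u, \<delta>, \<omega>). lyapunov_rate S x u + lam * lyapunov S x \<le> \<delta> \<and>
        barrier_rate S x u + \<omega> * gam0 * barrier S x \<ge> 0 \<and> u \<in> inputs S}"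

definition safety_first_constraints ::
  "('n::finite, 'm::finite) control_data \<Rightarrow> real \<Rightarrow> real \<Rightarrow> real^'n \<Rightarrow>
     ((real^'m) \<times> real \<times> real) set" where
  "safety_first_constraints S lam gam x =
     {(u, \<delta>1, \<delta>2). lyapunov_rate S x u + lam * lyapunov S x \<le> \<delta>1 \<and>
        barrier_rate S x u + gam * barrier S x \<ge> \<delta>2 \<and> u \<in> inputs S}"

definition safety_first_1 ::
  "('n::finite, 'm::finite) control_data \<Rightarrow> real \<Rightarrow> real \<Rightarrow> real^'n \<Rightarrow>
     ((real^'m) \<times> real \<times> real) program" where
  "safety_first_1 S lam gam x = Minimize
     (\<lambda>(u, \<delta>1, \<delta>2). \<delta>2\<^sup>2) (safety_first_constraints S lam gam x)"

definition safety_first_2 ::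
  "('n::finite, 'm::finite) control_data \<Rightarrow> real \<Rightarrow> real \<Rightarrow> real^'n \<Rightarrow> real \<Rightarrow>
     ((real^'m) \<times> real) program" where
  "safety_first_2 S lam gam x \<delta>2 = Minimize
     (\<lambda>(u, \<delta>1). \<delta>1\<^sup>2) {(u, \<delta>1). (u, \<delta>1, \<delta>2) \<in> safety_first_constraints S lam gam x}"

definition safety_first_3 ::
  "('n::finite, 'm::finite) control_data \<Rightarrow> real \<Rightarrow> real \<Rightarrow> real^'n \<Rightarrow> real \<Rightarrow> real \<Rightarrow>
     (real^'m) program" where
  "safety_first_3 S lam gam x \<delta>1 \<delta>2 = Minimize
     (deviation_cost S x) {u. (u, \<delta>1, \<delta>2) \<in> safety_first_constraints S lam gam x}"

definition optimal_safety_slack ::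
  "('n::finite, 'm::finite) control_data \<Rightarrow> real \<Rightarrow> real \<Rightarrow> real^'n \<Rightarrow> real \<Rightarrow> bool" where
  "optimal_safety_slack S lam gam x \<delta>2 \<longleftrightarrow>
     (\<exists>u \<delta>1. minimizer (safety_first_1 S lam gam x) (u, \<delta>1, \<delta>2))"

definition optimal_stability_slack ::
  "('n::finite, 'm::finite) control_data \<Rightarrow> real \<Rightarrow> real \<Rightarrow> real^'n \<Rightarrow> real \<Rightarrow> real \<Rightarrow> bool" where
  "optimal_stability_slack S lam gam x \<delta>2 \<delta>1 \<longleftrightarrow>
     (\<exists>u. minimizer (safety_first_2 S lam gam x \<delta>2) (u, \<delta>1))"

text \<open>The second and third problems are posed only once the optimal slacks of their predecessors
  exist, so feasibility of the nested problem includes the existence of these optimal values.\<close>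

definition safety_first_feasible ::
  "('n::finite, 'm::finite) control_data \<Rightarrow> real \<Rightarrow> real \<Rightarrow> real^'n \<Rightarrow> bool" where
  "safety_first_feasible S lam gam x \<longleftrightarrow>
     feasible (safety_first_1 S lam gam x) \<and>
     (\<exists>\<delta>2. optimal_safety_slack S lam gam x \<delta>2) \<and>
     (\<forall>\<delta>2. optimal_safety_slack S lam gam x \<delta>2 \<longrightarrow>
        feasible (safety_first_2 S lam gam x \<delta>2) \<and>
        (\<exists>\<delta>1. optimal_stability_slack S lam gam x \<delta>2 \<delta>1) \<and>
        (\<forall>\<delta>1. optimal_stability_slack S lam gam x \<delta>2 \<delta>1 \<longrightarrow>
           feasible (safety_first_3 S lam gam x \<delta>1 \<delta>2)))"

end

theory Submission
  imports Defs
begin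

text \<open>A CBF only has to admit \<^emph>\<open>some\<close> class K function. For the uncontrolled system
  \<open>x' = -x\<close> the barrier \<open>h(x) = \<langle>a, x\<rangle>\<close> satisfies \<open>L\<^sub>f h = -h\<close>, so \<open>\<alpha>(r) = r\<close> works, while the
  linear rate \<open>\<gamma> = 1/2\<close> makes the constraint fail wherever \<open>h > 0\<close>.
  In the optimal-decay problem \<open>\<omega> = -(L\<^sub>f h + L\<^sub>g h u) / (\<gamma>\<^sub>0 h)\<close> is always available. In the
  safety-first problem the slacks make every constraint satisfiable, and the optimal slacks are
  attained because the input set is compact and the rates are affine in the input.\<close>

text \<open>A vector is determined by its inner products with all vectors, so uniqueness of the
  Frechet derivative passes to gradients. This lets the description operator in \<open>grad\<close>
  be evaluated.\<close>

lemma GDERIV_unique: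
  assumes "GDERIV W x :> d" "GDERIV W x :> e"
  shows "d = e"
proof -
  have "(\<lambda>v. v \<bullet> d) = (\<lambda>v. v \<bullet> e)"
    using assms unfolding gderiv_def by (rule has_derivative_unique)
  then show ?thesis
    by (metis vector_eq_ldot)
qed

lemma grad_eqI: "GDERIV W x :> d \<Longrightarrow> grad W x = d"
  unfolding grad_def by (rule the_equality) (auto intro: GDERIV_unique)

lemma C1_functionI:
  assumes "\<And>x. GDERIV W x :> d x" "continuous_on UNIV d"
  shows "C1_function W"
proof -
  have "grad W = d"
    using assms(1) by (auto intro: grad_eqI)
  moreover have "W differentiable (at x)" for x
    using assms(1)[of x] unfolding gderiv_def differentiable_def by blast
  ultimately show ?thesis
    using assms(2) by (simp add: C1_function_def)
qed

lemma GDERIV_inner_self: "GDERIV (\<lambda>x. x \<bullet> x) x :> 2 *\<^sub>R x"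
  unfolding gderiv_def
  by (auto intro!: derivative_eq_intros simp: inner_commute)

lemma GDERIV_inner_left: "GDERIV (\<lambda>x. a \<bullet> x) x :> a"
  unfolding gderiv_def
  by (auto intro!: derivative_eq_intros simp: inner_commute)

lemma local_lipschitz_lipschitz_on:
  fixes f :: "'a::metric_space \<Rightarrow> 'b::metric_space"
  assumes "L-lipschitz_on UNIV f"
  shows "local_lipschitz (UNIV :: real set) UNIV (\<lambda>_. f)"
  by (rule local_lipschitzI) (use assms in \<open>auto intro: zero_less_one lipschitz_on_subset\<close>)

lemma CLF_CBF_QP_infeasible_example:
  "\<exists>(S :: ('n::finite, 'm::finite) control_data) lam gam p x.
     control_setting S \<and> polytopic_inputs S \<and> lam > 0 \<and> gam > 0 \<and> p > 0 \<and>
     \<not> feasible (CLF_CBF_QP S lam gam p x)"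
proof -
  define a :: "real^'n" where "a = 1"
  define S :: "('n, 'm) control_data" where
    "S = \<lparr>drift = uminus, input_matrix = (\<lambda>_. 0), inputs = {0}, nominal = (\<lambda>_. 0),
          lyapunov = (\<lambda>x. x \<bullet> x), barrier = (\<lambda>x. a \<bullet> x), weight = mat 1\<rparr>"
  have a: "a \<bullet> a > 0"
    by (simp add: a_def)
  have grad_V: "grad (\<lambda>x::real^'n. x \<bullet> x) x = 2 *\<^sub>R x" for x
    by (rule grad_eqI[OF GDERIV_inner_self])
  have grad_h: "grad (\<lambda>x. a \<bullet> x) x = a" for x
    by (rule grad_eqI[OF GDERIV_inner_left])
  have C1: "C1_function (\<lambda>x::real^'n. x \<bullet> x)" "C1_function (\<lambda>x. a \<bullet> x)"
    by (rule C1_functionI[OF GDERIV_inner_self] C1_functionI[OF GDERIV_inner_left],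
        intro continuous_intros)+
  have "1-lipschitz_on UNIV (uminus :: real^'n \<Rightarrow> real^'n)"
    by (rule lipschitz_onI) (simp_all add: dist_minus)
  moreover have "0-lipschitz_on UNIV (\<lambda>_::real^'n. 0 :: real^'m^'n)"
    by (rule lipschitz_onI) simp_all
  \<comment> \<open>Here \<open>V\<close> is the squared norm, so both quadratic bounds hold with
    constant 1. Along the drift its rate is \<open>-2 * V x\<close>, which leaves room for decay
    constant 1.\<close>
  moreover have "exp_stabilizing_CLF uminus (\<lambda>_. 0 :: real^'m^'n) {0} (\<lambda>x. x \<bullet> x)"
    unfolding exp_stabilizing_CLF_def lie_def grad_V
    by (intro conjI C1 exI[of _ 1] exI[of _ "1::real"])
       (auto simp: power2_norm_eq_inner zero_ereal_def)
  moreover have "zeroing_CBF uminus (\<lambda>_. 0 :: real^'m^'n) {0} (\<lambda>x. a \<bullet> x)"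
    unfolding zeroing_CBF_def lie_def grad_h extended_class_K_infinity_def
    by (intro conjI C1 exI[of _ "\<lambda>r. r"])
       (auto simp: zero_ereal_def strict_mono_def filterlim_ident)
  moreover have "symmetric_positive_definite (mat 1 :: real^'m^'m)"
    by (simp add: symmetric_positive_definite_def)
  ultimately have "control_setting S"
    by (simp add: control_setting_def S_def local_lipschitz_lipschitz_on)
  moreover have "polytopic_inputs S"
    by (simp add: polytopic_inputs_def S_def polytope_sing)
  \<comment> \<open>At the state \<open>a\<close> the barrier constraint would read
    \<open>- (a \<bullet> a) + 1/2 * (a \<bullet> a) \<ge> 0\<close>. The deleted simp rule would
    turn the positivity fact \<open>a\<close> into \<open>a \<noteq> 0\<close>.\<close>
  moreover have "\<not> feasible (CLF_CBF_QP S 1 (1/2) 1 a)"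
    using a by (auto simp: feasible_def CLF_CBF_QP_def barrier_rate_def lie_def S_def grad_h
        simp del: inner_gt_zero_iff)
  ultimately show ?thesis
    by (intro exI[of _ S] exI[of _ 1] exI[of _ "1/2"] exI[of _ 1] exI[of _ a]) simp
qed

lemma optimal_decay_QP_feasible:
  assumes "nominal S x \<in> inputs S" "gam0 \<noteq> 0" "barrier S x \<noteq> 0"
  shows "feasible (optimal_decay_QP S lam gam0 p p\<omega> \<omega>0 x)"
proof -
  let ?u = "nominal S x"
  \<comment> \<open>The nominal input is kept, and \<delta> and \<omega> are chosen so that both
    relaxed constraints hold with equality.\<close>
  have "(?u, lyapunov_rate S x ?u + lam * lyapunov S x,
         - barrier_rate S x ?u / (gam0 * barrier S x))
        \<in> feasible_set (optimal_decay_QP S lam gam0 p p\<omega> \<omega>0 x)"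
    using assms by (simp add: optimal_decay_QP_def)
  then show ?thesis
    unfolding feasible_def by blast
qed

text \<open>Common core of the first two sub-problems. The slack ranges over an unbounded set, but
  only \<open>c\<close> has to be minimized, over the compact \<open>K\<close>; the best slack is
  then explicit.\<close>

lemma minimal_slack_attained:
  fixes c :: "'a::topological_space \<Rightarrow> real"
  assumes "compact K" "K \<noteq> {}" "continuous_on K c"
  obtains u d where "u \<in> K" "c u \<le> d" "\<And>v e. v \<in> K \<Longrightarrow> c v \<le> e \<Longrightarrow> d\<^sup>2 \<le> e\<^sup>2"
proof -
  obtain u where u: "u \<in> K" "\<And>v. v \<in> K \<Longrightarrow> c u \<le> c v"
    using continuous_attains_inf[OF assms] by blast
  show thesis
  \<comment> \<open>Among the slacks above \<open>c u\<close>, this one is closest to 0: it vanishes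
    if 0 is allowed, and otherwise it equals the positive minimum of \<open>c\<close>, where
    squaring is monotone.\<close>
  proof (rule that[of u "max 0 (c u)"])
    fix v e
    assume "v \<in> K" "c v \<le> e"
    then have "c u \<le> e"
      using u(2) by force
    then show "(max 0 (c u))\<^sup>2 \<le> e\<^sup>2"
      by (auto simp: max_def intro: power_mono)
  qed (use u in auto)
qed

lemma continuous_on_lyapunov_rate: "continuous_on A (lyapunov_rate S x)"
  unfolding lyapunov_rate_def[abs_def] by (intro continuous_intros)

lemma continuous_on_barrier_rate: "continuous_on A (barrier_rate S x)"
  unfolding barrier_rate_def[abs_def] by (intro continuous_intros)

lemma optimal_safety_slack_exists:
  assumes "compact (inputs S)" "inputs S \<noteq> {}"
  shows "\<exists>\<delta>2. optimal_safety_slack S lam gam x \<delta>2"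
proof -
  \<comment> \<open>The safety slack is bounded from above by the constraint, so signs are flipped:
    \<open>d\<close> plays the part of \<open>- \<delta>2\<close>, and the square is
    unchanged.\<close>
  have "continuous_on (inputs S) (\<lambda>u. - (barrier_rate S x u + gam * barrier S x))"
    by (intro continuous_intros continuous_on_barrier_rate)
  then obtain u d where u: "u \<in> inputs S" "- (barrier_rate S x u + gam * barrier S x) \<le> d"
    and min: "\<And>v e. v \<in> inputs S \<Longrightarrow> - (barrier_rate S x v + gam * barrier S x) \<le> e
                \<Longrightarrow> d\<^sup>2 \<le> e\<^sup>2"
    using minimal_slack_attained[OF assms] by blast
  have "d\<^sup>2 \<le> e\<^sup>2" if "v \<in> inputs S" "e \<le> barrier_rate S x v + gam * barrier S x" for v e
    using min[of v "- e"] that by simp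
  with u have "minimizer (safety_first_1 S lam gam x)
                 (u, lyapunov_rate S x u + lam * lyapunov S x, - d)"
    by (auto simp: minimizer_def is_arg_min_linorder safety_first_1_def
        safety_first_constraints_def)
  then show ?thesis
    unfolding optimal_safety_slack_def by blast
qed

lemma optimal_stability_slack_exists:
  assumes "compact (inputs S)" "feasible (safety_first_2 S lam gam x \<delta>2)"
  shows "\<exists>\<delta>1. optimal_stability_slack S lam gam x \<delta>2 \<delta>1"
proof -
  \<comment> \<open>Fixing \<delta>2 turns the barrier constraint into a closed condition on the
    input, so the admissible inputs remain compact.\<close>
  let ?K = "{u \<in> inputs S. \<delta>2 \<le> barrier_rate S x u + gam * barrier S x}"
  have "closed {u. \<delta>2 \<le> barrier_rate S x u + gam * barrier S x}"
    by (intro closed_Collect_le continuous_intros continuous_on_barrier_rate)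
  then have "compact ?K"
    using assms(1) by (simp add: Collect_conj_eq compact_Int_closed)
  moreover have "?K \<noteq> {}"
    using assms(2)
    by (auto simp: feasible_def safety_first_2_def safety_first_constraints_def)
  moreover have "continuous_on ?K (\<lambda>u. lyapunov_rate S x u + lam * lyapunov S x)"
    by (intro continuous_intros continuous_on_lyapunov_rate)
  ultimately obtain u d where "u \<in> ?K" "lyapunov_rate S x u + lam * lyapunov S x \<le> d"
    "\<And>v e. v \<in> ?K \<Longrightarrow> lyapunov_rate S x v + lam * lyapunov S x \<le> e \<Longrightarrow> d\<^sup>2 \<le> e\<^sup>2"
    by (rule minimal_slack_attained) blast
  then have "minimizer (safety_first_2 S lam gam x \<delta>2) (u, d)"
    by (auto simp: minimizer_def is_arg_min_linorder safety_first_2_def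
        safety_first_constraints_def)
  then show ?thesis
    unfolding optimal_stability_slack_def by blast
qed

text \<open>A minimizer of one sub-problem, with its slack frozen at the optimal value, is itself a
  feasible point of the next. Only the existence of the two optimal slacks needs
  compactness.\<close>

lemma safety_first_feasible_compact:
  assumes "compact (inputs S)" "inputs S \<noteq> {}"
  shows "safety_first_feasible S lam gam x"
proof -
  have 1: "feasible (safety_first_2 S lam gam x \<delta>2)" "feasible (safety_first_1 S lam gam x)"
    if "optimal_safety_slack S lam gam x \<delta>2" for \<delta>2
    using that
    by (auto simp: optimal_safety_slack_def minimizer_def is_arg_min_def feasible_def
        safety_first_1_def safety_first_2_def)
  have 2: "feasible (safety_first_3 S lam gam x \<delta>1 \<delta>2)"
    if "optimal_stability_slack S lam gam x \<delta>2 \<delta>1" for \<delta>1 \<delta>2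
    using that
    by (auto simp: optimal_stability_slack_def minimizer_def is_arg_min_def feasible_def
        safety_first_2_def safety_first_3_def)
  show ?thesis
    unfolding safety_first_feasible_def
    using 1 2 optimal_safety_slack_exists[OF assms]
      optimal_stability_slack_exists[OF assms(1)] by blast
qed

theorem corollary2:
  shows "(\<exists>(S :: ('n::finite, 'm::finite) control_data) lam gam p x.
            control_setting S \<and> polytopic_inputs S \<and> lam > 0 \<and> gam > 0 \<and> p > 0 \<and>
            \<not> feasible (CLF_CBF_QP S lam gam p x)) \<and>
         (\<forall>(S :: ('n::finite, 'm::finite) control_data) lam gam0 p p\<omega> \<omega>0 x.
            control_setting S \<and> polytopic_inputs S \<and> lam > 0 \<and> gam0 > 0 \<and> p > 0 \<and> p\<omega> > 0 \<and>
            barrier S x \<noteq> 0 \<longrightarrow>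
            feasible (optimal_decay_QP S lam gam0 p p\<omega> \<omega>0 x)) \<and>
         (\<forall>(S :: ('n::finite, 'm::finite) control_data) lam gam x.
            control_setting S \<and> polytopic_inputs S \<and> lam > 0 \<and> gam > 0 \<longrightarrow>
            safety_first_feasible S lam gam x)"
proof (intro conjI allI impI)
  show "\<exists>(S :: ('n, 'm) control_data) lam gam p x.
          control_setting S \<and> polytopic_inputs S \<and> lam > 0 \<and> gam > 0 \<and> p > 0 \<and>
          \<not> feasible (CLF_CBF_QP S lam gam p x)"
    by (rule CLF_CBF_QP_infeasible_example)
\<comment> \<open>The nominal control witnesses that the input set is nonempty, and a polytope is
  compact.\<close>
qed (auto simp: polytopic_inputs_def
    intro!: optimal_decay_QP_feasible safety_first_feasible_compact polytope_imp_compact)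

end
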